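(* Let $X$ be a finite topological $T_0$-space which is a minimal finite space (i.e. $X$ has no beat points). If $\varphi:\mathbb{R}_0^+\times X\rightarrow X$ is a semiflow, then $\varphi$ is trivial.
   Context: For a finite topological $T_0$-space $X$ and $x\in X$, $U_x$ (resp. $F_x$) is the intersection of all open (resp. closed) sets containing $x$. The relation $x\leq y \iff U_x\subseteq U_y$ is a partial order on $X$, so $U_x=\{y: y\le x\}$ and $F_x=\{y: y\ge x\}$; open sets are exactly the lower sets. A point $x\in X$ is a down beat point if $U_x\setminus\{x\}$ has a maximum, and an up beat point if $F_x\setminus\{x\}$ has a minimum; a beat point is a down or up beat point. A minimal finite space is a finite $T_0$-space without beat points. $\mathbb{R}_0^+$ is the set of non-negative real numbers with the usual topology. A semiflow on $X$ is a continuous map $\varphi:\mathbb{R}_0^+\times X\to X$ (product topology on the domain) such that $\varphi(0,x)=x$ for all $x\in X$ and $\varphi(s,\varphi(t,x))=\varphi(s+t,x)$ for all $x\in X$, $s,t\in\mathbb{R}_0^+$. It is trivial if $\varphi(t,\cdot)$ is the identity map of $X$ for every $t\in\mathbb{R}_0^+$. *)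

theory Defs
  imports "HOL-Analysis.Analysis"
begin

definition minimal_open :: "'a topology \<Rightarrow> 'a \<Rightarrow> 'a set" where
  "minimal_open X x = \<Inter>{U. openin X U \<and> x \<in> U}"

definition minimal_closed :: "'a topology \<Rightarrow> 'a \<Rightarrow> 'a set" where
  "minimal_closed X x = \<Inter>{C. closedin X C \<and> x \<in> C}"

text \<open>The order is the one for which open sets are lower sets; it is meant to be used only for
  points of \<^term>\<open>topspace X\<close>.\<close>

definition space_le :: "'a topology \<Rightarrow> 'a \<Rightarrow> 'a \<Rightarrow> bool" where
  "space_le X x y \<longleftrightarrow> minimal_open X x \<subseteq> minimal_open X y"

definition has_maximum :: "'a topology \<Rightarrow> 'a set \<Rightarrow> bool" where
  "has_maximum X S \<longleftrightarrow> (\<exists>m\<in>S. \<forall>y\<in>S. space_le X y m)"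

definition has_minimum :: "'a topology \<Rightarrow> 'a set \<Rightarrow> bool" where
  "has_minimum X S \<longleftrightarrow> (\<exists>m\<in>S. \<forall>y\<in>S. space_le X m y)"

definition down_beat_point :: "'a topology \<Rightarrow> 'a \<Rightarrow> bool" where
  "down_beat_point X x \<longleftrightarrow> x \<in> topspace X \<and> has_maximum X (minimal_open X x - {x})"

definition up_beat_point :: "'a topology \<Rightarrow> 'a \<Rightarrow> bool" where
  "up_beat_point X x \<longleftrightarrow> x \<in> topspace X \<and> has_minimum X (minimal_closed X x - {x})"

definition beat_point :: "'a topology \<Rightarrow> 'a \<Rightarrow> bool" where
  "beat_point X x \<longleftrightarrow> down_beat_point X x \<or> up_beat_point X x"

definition minimal_finite_space :: "'a topology \<Rightarrow> bool" where
  "minimal_finite_space X \<longleftrightarrow>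
     finite (topspace X) \<and> t0_space X \<and> (\<nexists>x. beat_point X x)"

text \<open>Only the values of \<^term>\<open>\<phi>\<close> on \<^term>\<open>{0::real..} \<times> topspace X\<close> are relevant;
  \<^const>\<open>continuous_map\<close> includes that these values lie in \<^term>\<open>topspace X\<close>.\<close>

definition semiflow :: "'a topology \<Rightarrow> (real \<times> 'a \<Rightarrow> 'a) \<Rightarrow> bool" where
  "semiflow X \<phi> \<longleftrightarrow>
     continuous_map (prod_topology (top_of_set {0..}) X) X \<phi> \<and>
     (\<forall>x\<in>topspace X. \<phi> (0, x) = x) \<and>
     (\<forall>x\<in>topspace X. \<forall>s\<ge>0. \<forall>t\<ge>0. \<phi> (s, \<phi> (t, x)) = \<phi> (s + t, x))"

definition trivial_semiflow :: "'a topology \<Rightarrow> (real \<times> 'a \<Rightarrow> 'a) \<Rightarrow> bool" where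
  "trivial_semiflow X \<phi> \<longleftrightarrow> (\<forall>t\<ge>0. \<forall>x\<in>topspace X. \<phi> (t, x) = x)"

end

theory Submission
  imports Defs
begin

text \<open>For each point \<open>x\<close> the open set \<open>U\<^sub>x\<close> contains \<open>\<phi> (t, x)\<close> for all small \<open>t\<close>; as the space is
  finite, there is \<open>\<epsilon> > 0\<close> with \<open>\<phi> (t, x) \<le> x\<close> for all \<open>x\<close> and all \<open>t < \<epsilon>\<close>.
  In a space without down beat points a continuous map \<open>f \<le> id\<close> is the identity: if \<open>x\<close> is a minimal
  point that is moved, then \<open>y = f y \<le> f x\<close> for every \<open>y < x\<close>, so \<open>f x\<close> is the maximum of
  \<open>U\<^sub>x - {x}\<close>. Hence the flow is trivial for times below \<open>\<epsilon>\<close>, and by the semigroup law for all times.\<close>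

lemma minimal_open_self: "x \<in> minimal_open X x"
  by (simp add: minimal_open_def)

lemma minimal_open_least: "openin X U \<Longrightarrow> x \<in> U \<Longrightarrow> minimal_open X x \<subseteq> U"
  by (auto simp: minimal_open_def)

text \<open>A finite space has only finitely many open sets, so the intersection is a finite one.
  The family is nonempty because \<open>topspace X\<close> itself contains \<open>x\<close>.\<close>

lemma openin_minimal_open:
  assumes "finite (topspace X)" "x \<in> topspace X"
  shows "openin X (minimal_open X x)"
proof -
  have "{U. openin X U \<and> x \<in> U} \<subseteq> Pow (topspace X)"
    by (auto dest: openin_subset)
  then have "finite {U. openin X U \<and> x \<in> U}"
    using assms(1) finite_subset by blast
  then show ?thesis
    unfolding minimal_open_def using assms(2) by (intro openin_Inter) auto
qed

lemma minimal_open_subset_topspace: "x \<in> topspace X \<Longrightarrow> minimal_open X x \<subseteq> topspace X"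
  by (simp add: minimal_open_least)

lemma minimal_open_psubset:
  assumes "finite (topspace X)" "t0_space X" "x \<in> topspace X"
    and "y \<in> minimal_open X x" "y \<noteq> x"
  shows "minimal_open X y \<subset> minimal_open X x"
proof -
  have y: "y \<in> topspace X"
    using minimal_open_subset_topspace[OF assms(3)] assms(4) by blast
  have le: "minimal_open X y \<subseteq> minimal_open X x"
    using assms by (intro minimal_open_least openin_minimal_open)
  obtain U where U: "openin X U" "x \<notin> U \<longleftrightarrow> y \<in> U"
    using assms(2,3,5) y unfolding t0_space_def by blast
  \<comment> \<open>The T0 axiom does not say which of the two points \<open>U\<close> contains. If
    it were \<open>x\<close>, then \<open>U\<close> would include \<open>minimal_open X x\<close>
    and with it \<open>y\<close>, so it is \<open>y\<close>.\<close>
  have "y \<in> U"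
    using U minimal_open_least[of X U x] assms(4) by blast
  then have "x \<notin> minimal_open X y"
    using U minimal_open_least[of X U y] by blast
  then show ?thesis
    using le minimal_open_self[of x X] by blast
qed

text \<open>Continuous maps are monotone for the order: the preimage of the least neighbourhood of
  \<open>f x\<close> is an open neighbourhood of \<open>x\<close>, hence includes the least
  one.\<close>

lemma continuous_map_minimal_open:
  assumes "finite (topspace Y)" "continuous_map X Y f" "x \<in> topspace X" "y \<in> minimal_open X x"
  shows "f y \<in> minimal_open Y (f x)"
proof -
  have "f x \<in> topspace Y"
    using continuous_map_image_subset_topspace[OF assms(2)] assms(3) by blast
  then have "openin X {z \<in> topspace X. f z \<in> minimal_open Y (f x)}"
    by (rule openin_continuous_map_preimage[OF assms(2) openin_minimal_open[OF assms(1)]])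
  then have "minimal_open X x \<subseteq> {z \<in> topspace X. f z \<in> minimal_open Y (f x)}"
    using assms(3) by (intro minimal_open_least) (auto simp: minimal_open_self)
  then show ?thesis
    using assms(4) by blast
qed

lemma continuous_map_below_id_eq_id:
  assumes fin: "finite (topspace X)" and t0: "t0_space X"
    and nobeat: "\<And>x. \<not> down_beat_point X x"
    and cont: "continuous_map X X f"
    and below: "\<And>x. x \<in> topspace X \<Longrightarrow> f x \<in> minimal_open X x"
    and "x \<in> topspace X"
  shows "f x = x"
  using \<open>x \<in> topspace X\<close>
\<comment> \<open>This measure drops strictly when passing from \<open>x\<close> to a point below
  it, so the induction hypothesis makes \<open>f\<close> fix all such points.\<close>
proof (induction "card (minimal_open X x)" arbitrary: x rule: less_induct)
  case less
  have fixed: "f y = y" if y: "y \<in> minimal_open X x - {x}" for y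
  proof (rule less.hyps)
    have "minimal_open X y \<subset> minimal_open X x"
      using y less.prems fin t0 by (intro minimal_open_psubset) auto
    moreover have "finite (minimal_open X x)"
      using finite_subset[OF minimal_open_subset_topspace[OF less.prems] fin] .
    ultimately show "card (minimal_open X y) < card (minimal_open X x)"
      by (rule psubset_card_mono[rotated])
    show "y \<in> topspace X"
      using y minimal_open_subset_topspace[OF less.prems] by blast
  qed
  show ?case
  proof (rule ccontr)
    assume "f x \<noteq> x"
    then have fx: "f x \<in> minimal_open X x - {x}"
      using below[OF less.prems] by blast
    then have "f x \<in> topspace X"
      using minimal_open_subset_topspace[OF less.prems] by blast
    have "space_le X y (f x)" if "y \<in> minimal_open X x - {x}" for y
    proof -
      \<comment> \<open>Monotonicity puts \<open>f y\<close> below \<open>f x\<close>, and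
        \<open>f y\<close> is \<open>y\<close> by \<open>fixed\<close>.\<close>
      have "y \<in> minimal_open X (f x)"
        using continuous_map_minimal_open[OF fin cont less.prems, of y] fixed that by simp
      then show ?thesis
        unfolding space_le_def using fin \<open>f x \<in> topspace X\<close>
        by (intro minimal_open_least openin_minimal_open)
    qed
    then have "down_beat_point X x"
      using fx less.prems unfolding down_beat_point_def has_maximum_def by blast
    then show False
      using nobeat by blast
  qed
qed

lemma semiflow_continuous_space:
  assumes "semiflow X \<phi>" "t \<ge> 0"
  shows "continuous_map X X (\<lambda>x. \<phi> (t, x))"
proof -
  have "continuous_map X (prod_topology (top_of_set {0..}) X) (\<lambda>x. (t, x))"
    using assms(2) by (intro continuous_map_pairedI) auto
  then show ?thesis
    using assms(1) continuous_map_compose[of X _ "\<lambda>x. (t, x)" X \<phi>]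
    by (auto simp: semiflow_def o_def)
qed

lemma semiflow_continuous_time:
  assumes "semiflow X \<phi>" "x \<in> topspace X"
  shows "continuous_map (top_of_set {0..}) X (\<lambda>t. \<phi> (t, x))"
proof -
  have "continuous_map (top_of_set {0..}) (prod_topology (top_of_set {0..}) X) (\<lambda>t. (t, x))"
    using assms(2) by (intro continuous_map_pairedI) auto
  then show ?thesis
    using assms(1) continuous_map_compose[of _ _ "\<lambda>t. (t, x)" X \<phi>]
    by (auto simp: semiflow_def o_def)
qed

lemma semiflow_eventually_below:
  assumes "semiflow X \<phi>" "finite (topspace X)"
  shows "\<forall>\<^sub>F t in at_right 0. \<forall>x\<in>topspace X. \<phi> (t, x) \<in> minimal_open X x"
proof -
  have "\<forall>\<^sub>F t in at_right 0. \<phi> (t, x) \<in> minimal_open X x" if x: "x \<in> topspace X" for x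
  proof -
    have "openin (top_of_set {0..}) {t \<in> {0..}. \<phi> (t, x) \<in> minimal_open X x}"
      using openin_continuous_map_preimage[OF semiflow_continuous_time openin_minimal_open]
        assms x by fastforce
    then obtain T where T: "open T" "{t \<in> {0..}. \<phi> (t, x) \<in> minimal_open X x} = {0..} \<inter> T"
      by (auto simp: openin_open)
    have "\<phi> (0, x) = x"
      using assms(1) x by (simp add: semiflow_def)
    then have "0 \<in> T"
      using T(2)[THEN eq_refl, THEN subsetD, of 0] minimal_open_self[of x X] by simp
    then have "\<forall>\<^sub>F t in at_right 0. t \<in> T"
      using eventually_at_topological T(1) by blast
    \<comment> \<open>\<open>T\<close> is open in the whole real line and controls the flow only at
      its nonnegative members.\<close>
    moreover have "\<forall>\<^sub>F t in at_right 0. t > (0::real)"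
      by (rule eventually_at_right_less)
    ultimately show ?thesis
    proof eventually_elim
      case (elim t)
      then show ?case
        using T(2)[THEN eq_refl[OF sym], THEN subsetD, of t] by simp
    qed
  qed
  \<comment> \<open>Finitely many points allow one common bound on the times.\<close>
  then show ?thesis
    using assms(2) by (simp add: eventually_ball_finite)
qed

lemma semiflow_fixes_multiple:
  assumes "semiflow X \<phi>" "s \<ge> 0" "x \<in> topspace X" "\<phi> (s, x) = x"
  shows "\<phi> (real n * s, x) = x"
proof (induction n)
  case 0
  then show ?case
    using assms by (simp add: semiflow_def)
next
  case (Suc n)
  have "\<phi> (s, \<phi> (real n * s, x)) = \<phi> (s + real n * s, x)"
    using assms by (simp add: semiflow_def)
  then show ?case
    using Suc assms(4) by (simp add: algebra_simps)
qed

theorem theorem3p2: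
  fixes X :: "'a topology" and \<phi> :: "real \<times> 'a \<Rightarrow> 'a"
  assumes "minimal_finite_space X"
    and "semiflow X \<phi>"
  shows "trivial_semiflow X \<phi>"
proof -
  have fin: "finite (topspace X)" and t0: "t0_space X" and nobeat: "\<not> down_beat_point X x" for x
    using assms(1) by (auto simp: minimal_finite_space_def beat_point_def)
  obtain \<epsilon> where \<epsilon>: "\<epsilon> > 0"
    "\<And>t x. 0 < t \<Longrightarrow> t < \<epsilon> \<Longrightarrow> x \<in> topspace X \<Longrightarrow> \<phi> (t, x) \<in> minimal_open X x"
    using semiflow_eventually_below[OF assms(2) fin] by (auto simp: eventually_at_right_field)
  have small: "\<phi> (t, x) = x" if "0 < t" "t < \<epsilon>" "x \<in> topspace X" for t x
    using continuous_map_below_id_eq_id[OF fin t0 nobeat semiflow_continuous_space[OF assms(2)]]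
      \<epsilon>(2) that by force
  have "\<phi> (t, x) = x" if "t \<ge> 0" and x: "x \<in> topspace X" for t x
  \<comment> \<open>Time 0 is split off because \<open>small\<close> covers only strictly positive
    times.\<close>
  proof (cases "t = 0")
    case True
    then show ?thesis
      using assms(2) x by (simp add: semiflow_def)
  next
    case False
    \<comment> \<open>By the Archimedean property, \<open>t\<close> is cut into \<open>n\<close>
      equal steps shorter than \<open>\<epsilon>\<close>; each step fixes \<open>x\<close>, hence so
      does their composite.\<close>
    obtain n :: nat where n: "t < real n * \<epsilon>"
      using ex_less_of_nat_mult[OF \<epsilon>(1)] by blast
    then have "n > 0"
      using \<open>t \<ge> 0\<close> by (cases n) auto
    then have s: "0 < t / real n" "t / real n < \<epsilon>"
      using False \<open>t \<ge> 0\<close> n by (simp_all add: field_simps)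
    then show ?thesis
      using semiflow_fixes_multiple[OF assms(2) _ x small[OF s x], of n] \<open>n > 0\<close> by simp
  qed
  then show ?thesis
    by (simp add: trivial_semiflow_def)
qed

end
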